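(* Let $G\in C^r(B,\bar B)$ and $z(\cdot)\in C^r(U,B)$ with $z(0)=0$, and let $L(\varepsilon)=G'[z(\varepsilon)]$. Assume the family $L(\varepsilon)$ to be $k$-surjective ($k\ge0$) with all subspaces closed in the associated direct sums $B=N_1^c\oplus\cdots\oplus N_{k+1}^c\oplus N_{k+1}$, $\bar B=R_1\oplus\cdots\oplus R_{k+1}$. Let $S_1,\dots,S_{k+1}$, $p_k(\varepsilon)$ and the linearizing map $\Psi^c$ on $U\times V$ be as described in the context. (i) Assume $$G[z(\varepsilon)]=\varepsilon^{2k}\,\bar b(\varepsilon)\quad\text{with}\quad\|\bar b(0)\|\ll1 .$$ Then $G[z(\varepsilon)]$ can be absorbed into the linear part by the shift $$\varphi_0(\varepsilon):=-(S_1\cdots S_{k+1})^{-1}\cdot\bar b(\varepsilon)\in N^c$$ in $\varphi\in N^c$, i.e. $$G\big[z(\varepsilon)+\varepsilon^kp_k(\varepsilon)\{\Psi^c(\varepsilon,\varphi+\varphi_0(\varepsilon),n_{k+1})+n_{k+1}\}\big]=\varepsilon^{2k}(S_1\cdots S_{k+1})\cdot\varphi .$$ In the generalized cone $$z=z(\varepsilon)+\varepsilon^kp_k(\varepsilon)\{\Psi^c(\varepsilon,\bar\varphi,n_{k+1})+n_{k+1}\},\qquad \varepsilon\in U\setminus\{0\},\ (\bar\varphi,n_{k+1})\in V,$$ all solutions of $G[z]=0$ are given by setting $\varphi=0$, i.e. by $$z=z(\varepsilon)+\varepsilon^kp_k(\varepsilon)\{\Psi^c(\varepsilon,\varphi_0(\varepsilon),n_{k+1})+n_{k+1}\}.$$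 (ii) Assume $k\ge1$. If $z(\varepsilon)$ is not an approximation of order $2k$, in the sense that $$G[z(\varepsilon)]=\varepsilon^q\,\bar b(\varepsilon)\quad\text{with}\quad 0\le q\le2k-1\ \text{ and }\ \bar b(0)\ne0,$$ then no zero of $G[z]$ occurs in the generalized cone $$z=z(\varepsilon)+\varepsilon^kp_k(\varepsilon)\{\Psi^c(\varepsilon,\bar\varphi,n_{k+1})+n_{k+1}\},\qquad \varepsilon\in U\setminus\{0\},\ (\bar\varphi,n_{k+1})\in V.$$
   Context: $B,\bar B$ are real or complex Banach spaces over $\mathbb K=\mathbb R$ or $\mathbb C$; $U\subset\mathbb K$ is an open neighbourhood of $0$, which may be shrunk; $r\ge2$ is chosen sufficiently large. "Smooth" means continuously differentiable up to some finite order, which may be prescribed provided $r$ is large enough (depending on $k$). The function $\bar b(\cdot):U\to\bar B$ is smooth. $L[X,Y]$ denotes bounded linear operators, $GL[X,Y]$ bounded bijective linear operators with bounded inverse. $k$-surjectivity: the family $L(\varepsilon)\in L[B,\bar B]$, $\varepsilon\in U$, is called $k$-surjective ($k\ge0$) if for every $\bar b\in\bar B$ there are $b_0,\dots,b_k\in B$ such that $b(\varepsilon)=b_0+\varepsilon b_1+\cdots+\varepsilon^kb_k$ satisfies $L(\varepsilon)b(\varepsilon)=\varepsilon^k\bar b+\varepsilon^{k+1}r(\varepsilon)$ with a smooth remainder $r(\varepsilon)$. Associated direct sums: it is known that $k$-surjectivity of $L(\varepsilon)$ is equivalent to the existence of direct sums $B=N_1^c\oplus\cdots\oplus N_{k+1}^c\oplus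 N_{k+1}$, $\bar B=R_1\oplus\cdots\oplus R_{k+1}$, operators $S_1,\dots,S_{k+1}\in L[B,\bar B]$ whose restrictions satisfy $S_i\in GL[N_i^c,R_i]$, and a polynomial family $p_k(\varepsilon)=I_B+\varepsilon\phi_1+\cdots+\varepsilon^k\phi_k$ with $\phi_i\in L[B,N_1^c\oplus\cdots\oplus N_{k+1-i}^c]$, $i=1,\dots,k$, such that $$L(\varepsilon)p_k(\varepsilon)n_{i+1}^c=\varepsilon^iS_{i+1}n_{i+1}^c+O(\varepsilon^{i+1})\ (n_{i+1}^c\in N_{i+1}^c,\ i=0,\dots,k),\qquad L(\varepsilon)p_k(\varepsilon)n_{k+1}=O(\varepsilon^{k+1})\ (n_{k+1}\in N_{k+1}),$$ and such that $P_k(\varepsilon)=S_1+\varepsilon S_2+\cdots+\varepsilon^kS_{k+1}$ is lower triangular with respect to these direct sums (zero on $N_{k+1}$; $(R_j,N_i^c)$ block zero for $j<i$; $(R_i,N_i^c)$ block equal to $\varepsilon^{i-1}S_i$). Put $N^c:=N_1^c\times\cdots\times N_{k+1}^c$; the row operator $(S_1\cdots S_{k+1})\in GL[N^c,\bar B]$ is $\varphi\mapsto S_1\varphi_1+\cdots+S_{k+1}\varphi_{k+1}$. For $k=0$: $p_0=I_B$, $S_1=G'[0]$, $N_1=\ker G'[0]$, $R_1=\bar B$. Linearizing map: under the stated $k$-surjectivity and closedness assumptions there is, with $V=\{(\varphi,n_{k+1})\in N^c\times N_{k+1}\mid\|(\varphi,n_{k+1})\|<\rho\}$, $\rho>0$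 small, and $U$ suitably small, a smooth map $\Psi^c:U\times V\to N_1^c\oplus\cdots\oplus N_{k+1}^c$ of the form $\Psi^c=\varepsilon^k\psi_1^c+\cdots+\varepsilon\psi_k^c+\psi_{k+1}^c$, $\psi_i^c$ smooth with values in $N_i^c$, $\psi_i^c(\varepsilon,0,0)=0$, and $\psi_i^c(0,\varphi,n_{k+1})=\varphi_i+\chi_i^c(n_{k+1},\varphi_{k+1})\cdot\binom{n_{k+1}}{\varphi_{k+1}}^2$ with $\chi_i^c$ smooth and bilinear-operator valued, such that $$G[z(\varepsilon)+\varepsilon^kp_k(\varepsilon)\{\Psi^c(\varepsilon,\varphi,n_{k+1})+n_{k+1}\}]=G[z(\varepsilon)]+\varepsilon^{2k}(S_1\cdots S_{k+1})\cdot\varphi\quad\text{on }U\times V,$$ and such that for fixed $\varepsilon\in U\setminus\{0\}$ the map $(\varphi,n_{k+1})\mapsto z(\varepsilon)+\varepsilon^kp_k(\varepsilon)\{\Psi^c(\varepsilon,\varphi,n_{k+1})+n_{k+1}\}$ is a diffeomorphism from $V$ onto a neighbourhood of $z(\varepsilon)$ in $B$. "$\|\bar b(0)\|\ll1$" means that $\|\bar b(0)\|$ is smaller than a sufficiently small positive constant determined by $V$ and $(S_1\cdots S_{k+1})^{-1}$. The identity in (i) is understood for $\varepsilon\in U$ (after shrinking $U$) and sufficiently small $\varphi\in N^c$, $n_{k+1}\in N_{k+1}$; the solution formula is understood for those $n_{k+1}$ with $(\varphi_0(\varepsilon),n_{k+1})\in V$. *)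

theory Defs
  imports "HOL-Analysis.Analysis" "HOL-Library.Landau_Symbols"
begin

section \<open>The scalar field and Banach spaces over it\<close>

text \<open>The scalar field is either the reals or the complex numbers, up to isometric isomorphism.\<close>

class real_or_complex = real_normed_field +
  assumes real_or_complex:
    "\<exists>f :: 'a \<Rightarrow> complex.
       (\<forall>x y. f (x + y) = f x + f y) \<and> (\<forall>x y. f (x * y) = f x * f y) \<and>
       (\<forall>t. f (t *\<^sub>R 1) = complex_of_real t) \<and> (\<forall>x. norm (f x) = norm x) \<and>
       (range f = \<real> \<or> range f = UNIV)"

instance real :: real_or_complex
  by standard (rule exI[of _ complex_of_real], auto simp: Reals_def)

instance complex :: real_or_complex
  by standard (rule exI[of _ "\<lambda>x. x"], auto simp: scaleR_conv_of_real)

text \<open>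
  The ambient type classes only provide real scalars, so the scalar multiplication of a
  space over the field is an explicit argument, extending the real one.
\<close>

locale K_normed_space = vector_space scale
  for scale :: "'k::real_or_complex \<Rightarrow> 'a::real_normed_vector \<Rightarrow> 'a" +
  assumes scale_of_real: "scale (of_real t) x = t *\<^sub>R x"
    and norm_scale: "norm (scale c x) = norm c * norm x"

text \<open>Scalar multiplication on products, bounded sequences and bounded operators.\<close>

definition scale_prod ::
  "('k \<Rightarrow> 'a \<Rightarrow> 'a) \<Rightarrow> ('k \<Rightarrow> 'b \<Rightarrow> 'b) \<Rightarrow> 'k \<Rightarrow> 'a \<times> 'b \<Rightarrow> 'a \<times> 'b" where
  "scale_prod s1 s2 c x = (s1 c (fst x), s2 c (snd x))"

definition scale_seq ::
  "('k \<Rightarrow> 'a::real_normed_vector \<Rightarrow> 'a) \<Rightarrow> 'k \<Rightarrow> (nat \<Rightarrow>\<^sub>C 'a) \<Rightarrow> (nat \<Rightarrow>\<^sub>C 'a)" where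
  "scale_seq s c x = Bcontfun (\<lambda>i. s c (apply_bcontfun x i))"

lemma K_normed_space_scaleR: "K_normed_space (scaleR :: real \<Rightarrow> 'a::real_normed_vector \<Rightarrow> 'a)"
  by unfold_locales (auto simp: algebra_simps)

lemma K_normed_space_scale_seq:
  assumes "K_normed_space s"
  shows "apply_bcontfun (scale_seq s c x) i = s c (apply_bcontfun x i)"
    and "K_normed_space (scale_seq s)"
proof -
  interpret K_normed_space s by fact
  have app: "apply_bcontfun (scale_seq s c x) i = s c (apply_bcontfun x i)" for c x i
  proof -
    have "(\<lambda>i. s c (apply_bcontfun x i)) \<in> bcontfun"
    proof (rule bcontfun_normI)
      show "continuous_on UNIV (\<lambda>i. s c (apply_bcontfun x i))"
        by simp
      show "norm (s c (apply_bcontfun x i)) \<le> norm c * norm x" for i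
        by (simp add: norm_scale mult_left_mono norm_bounded)
    qed
    then show ?thesis by (simp add: scale_seq_def Bcontfun_inverse)
  qed
  show "apply_bcontfun (scale_seq s c x) i = s c (apply_bcontfun x i)" by (rule app)
  have le: "norm (scale_seq s c x) \<le> norm c * norm x" for c x
    by (rule norm_bound) (simp add: app norm_scale mult_left_mono norm_bounded)
  show "K_normed_space (scale_seq s)"
  proof unfold_locales
    fix c x show "norm (scale_seq s c x) = norm c * norm x"
    proof (cases "c = 0")
      case True then show ?thesis using le[of c x] by simp
    next
      case False
      have "scale_seq s (inverse c) (scale_seq s c x) = x"
        using False by (intro bcontfun_eqI) (simp add: app)
      then have "norm x \<le> inverse (norm c) * norm (scale_seq s c x)"
        using le[of "inverse c" "scale_seq s c x"] by (simp add: norm_inverse)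
      then show ?thesis using le[of c x] False by (simp add: field_simps)
    qed
  qed (auto intro!: bcontfun_eqI simp: app scale_right_distrib scale_left_distrib scale_of_real)
qed

definition scale_blinfun ::
  "('k \<Rightarrow> 'b::real_normed_vector \<Rightarrow> 'b) \<Rightarrow> 'k \<Rightarrow> ('a::real_normed_vector \<Rightarrow>\<^sub>L 'b) \<Rightarrow> ('a \<Rightarrow>\<^sub>L 'b)" where
  "scale_blinfun s c T = Blinfun (\<lambda>x. s c (blinfun_apply T x))"

definition bounded_K_linear ::
  "('k::real_or_complex \<Rightarrow> 'a::real_normed_vector \<Rightarrow> 'a) \<Rightarrow>
   ('k \<Rightarrow> 'b::real_normed_vector \<Rightarrow> 'b) \<Rightarrow> ('a \<Rightarrow> 'b) \<Rightarrow> bool" where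
  "bounded_K_linear sa sb T \<longleftrightarrow> Vector_Spaces.linear sa sb T \<and> bounded_linear T"

text \<open>
  The restriction of \<open>T\<close> to \<open>X\<close> is a bijection onto \<open>Y\<close> with bounded inverse; \<open>T\<close> itself is
  always a bounded linear operator below.
\<close>

definition GL_on ::
  "'a::real_normed_vector set \<Rightarrow> 'b::real_normed_vector set \<Rightarrow> ('a \<Rightarrow> 'b) \<Rightarrow> bool" where
  "GL_on X Y T \<longleftrightarrow> bij_betw T X Y \<and> (\<exists>c. \<forall>y\<in>Y. norm (the_inv_into X T y) \<le> c * norm y)"

section \<open>Continuously Frechet differentiable maps\<close>

text \<open>
  \<open>M\<close> is a bounded \<open>n\<close>-linear map on the subspace \<open>E\<close>; its \<open>n\<close> arguments are given as a list.
\<close>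

definition bounded_multilinear ::
  "('k \<Rightarrow> 'a::real_normed_vector \<Rightarrow> 'a) \<Rightarrow> ('k \<Rightarrow> 'b::real_normed_vector \<Rightarrow> 'b) \<Rightarrow>
   'a set \<Rightarrow> nat \<Rightarrow> ('a list \<Rightarrow> 'b) \<Rightarrow> bool" where
  "bounded_multilinear sa sb E n M \<longleftrightarrow>
     (\<forall>vs i u v c. set vs \<subseteq> E \<and> length vs = n \<and> i < n \<and> u \<in> E \<and> v \<in> E \<longrightarrow>
        M (vs[i := u + v]) = M (vs[i := u]) + M (vs[i := v]) \<and>
        M (vs[i := sa c u]) = sb c (M (vs[i := u]))) \<and>
     (\<exists>c. \<forall>vs. set vs \<subseteq> E \<and> length vs = n \<longrightarrow> norm (M vs) \<le> c * prod_list (map norm vs))"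

text \<open>
  \<open>f\<close> is \<open>r\<close> times continuously Frechet differentiable over the field on \<open>S\<close>, an open subset of
  the normed space \<open>E\<close> (a linear subspace of the ambient type).  \<open>D n x\<close> is the \<open>n\<close>-th derivative
  at \<open>x\<close>, an \<open>n\<close>-linear map on \<open>E\<close>; differentiability and continuity refer to the operator norm
  of multilinear maps.
\<close>

definition C_on ::
  "('k \<Rightarrow> 'a::real_normed_vector \<Rightarrow> 'a) \<Rightarrow> ('k \<Rightarrow> 'b::real_normed_vector \<Rightarrow> 'b) \<Rightarrow>
   nat \<Rightarrow> 'a set \<Rightarrow> 'a set \<Rightarrow> ('a \<Rightarrow> 'b) \<Rightarrow> bool" where
  "C_on sa sb r E S f \<longleftrightarrow> openin (top_of_set E) S \<and>
     (\<exists>D :: nat \<Rightarrow> 'a \<Rightarrow> 'a list \<Rightarrow> 'b.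
        (\<forall>x\<in>S. D 0 x [] = f x) \<and>
        (\<forall>n\<le>r. \<forall>x\<in>S. bounded_multilinear sa sb E n (D n x)) \<and>
        (\<forall>n<r. \<forall>x\<in>S. \<forall>e>0. \<exists>d>0. \<forall>h\<in>E. norm h < d \<and> x + h \<in> S \<longrightarrow>
           (\<forall>vs. set vs \<subseteq> E \<and> length vs = n \<longrightarrow>
              norm (D n (x + h) vs - D n x vs - D (Suc n) x (h # vs))
                \<le> e * norm h * prod_list (map norm vs))) \<and>
        (\<forall>n\<le>r. \<forall>x\<in>S. \<forall>e>0. \<exists>d>0. \<forall>y\<in>S. dist y x < d \<longrightarrow>
           (\<forall>vs. set vs \<subseteq> E \<and> length vs = n \<longrightarrow>
              norm (D n y vs - D n x vs) \<le> e * prod_list (map norm vs))))"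

lemma C_on_has_derivative:
  assumes "K_normed_space sa" "K_normed_space sb"
    and "C_on sa sb (Suc r) UNIV S f" and "x \<in> S"
  shows "(f has_derivative frechet_derivative f (at x)) (at x)"
    and "bounded_K_linear sa sb (frechet_derivative f (at x))"
proof -
  interpret a: K_normed_space sa by fact
  interpret b: K_normed_space sb by fact
  from assms obtain D where S: "open S" and D0: "\<forall>x\<in>S. D 0 x [] = f x"
    and B: "\<forall>n\<le>Suc r. \<forall>x\<in>S. bounded_multilinear sa sb UNIV n (D n x)"
    and der: "\<forall>n<Suc r. \<forall>x\<in>S. \<forall>e>0. \<exists>d>0. \<forall>h\<in>UNIV. norm h < d \<and> x + h \<in> S \<longrightarrow>
           (\<forall>vs. set vs \<subseteq> UNIV \<and> length vs = n \<longrightarrow>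
              norm (D n (x + h) vs - D n x vs - D (Suc n) x (h # vs))
                \<le> e * norm h * prod_list (map norm vs))"
    unfolding C_on_def by auto
  define T where "T h = D 1 x [h]" for h
  have M: "bounded_multilinear sa sb UNIV 1 (D 1 x)" using B \<open>x \<in> S\<close> by auto
  have add: "T (u + v) = T u + T v" and sc: "T (sa c u) = sb c (T u)" for u v c
    using M unfolding bounded_multilinear_def T_def
    by (metis One_nat_def UNIV_I length_Cons list.size(3) list_update_code(2) subset_UNIV zero_less_one)+
  obtain c where "\<forall>vs. set vs \<subseteq> UNIV \<and> length vs = 1 \<longrightarrow> norm (D 1 x vs) \<le> c * prod_list (map norm vs)"
    using M unfolding bounded_multilinear_def by blast
  then have bd: "norm (T h) \<le> c * norm h" for h unfolding T_def by (drule_tac x="[h]" in spec) simp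
  have bl: "bounded_linear T"
    by (rule bounded_linear_intro[where K = c])
       (use add sc bd a.scale_of_real b.scale_of_real in \<open>metis mult.commute\<close>)+
  have hd: "(f has_derivative T) (at x)"
    unfolding has_derivative_at_alt
  proof (intro conjI allI impI bl)
    fix e :: real assume "e > 0"
    then obtain d where "d > 0" and d: "\<And>h. norm h < d \<Longrightarrow> x + h \<in> S \<Longrightarrow>
        norm (f (x + h) - f x - T h) \<le> e * norm h"
      using der[rule_format, of 0 x e] D0 \<open>x \<in> S\<close> unfolding T_def by (auto; fastforce)
    obtain d' where "d' > 0" "ball x d' \<subseteq> S" using S \<open>x \<in> S\<close> openE by blast
    then have "norm (y - x) < d' \<Longrightarrow> y \<in> S" for y by (auto simp: dist_norm norm_minus_commute subset_iff)
    then show "\<exists>d>0. \<forall>y. norm (y - x) < d \<longrightarrow> norm (f y - f x - T (y - x)) \<le> e * norm (y - x)"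
      using d[of "_ - x"] \<open>d > 0\<close> \<open>d' > 0\<close> by (intro exI[of _ "min d d'"]) auto
  qed
  then have eq: "frechet_derivative f (at x) = T" using frechet_derivative_at by metis
  show "(f has_derivative frechet_derivative f (at x)) (at x)" using hd eq by simp
  show "bounded_K_linear sa sb (frechet_derivative f (at x))"
    unfolding eq bounded_K_linear_def using bl add sc
    by (auto simp: Vector_Spaces.linear_iff a.vector_space_axioms b.vector_space_axioms)
qed

definition C_diffeo_onto_nbhd ::
  "('k \<Rightarrow> 'a::real_normed_vector \<Rightarrow> 'a) \<Rightarrow> ('k \<Rightarrow> 'b::real_normed_vector \<Rightarrow> 'b) \<Rightarrow>
   nat \<Rightarrow> 'a set \<Rightarrow> 'a set \<Rightarrow> ('a \<Rightarrow> 'b) \<Rightarrow> 'b \<Rightarrow> bool" where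
  "C_diffeo_onto_nbhd sa sb s E V f y \<longleftrightarrow>
     inj_on f V \<and> open (f ` V) \<and> y \<in> f ` V \<and>
     C_on sa sb s E V f \<and> C_on sb sa s UNIV (f ` V) (the_inv_into V f)"

section \<open>Families of operators\<close>

definition k_surjective ::
  "('k::real_or_complex \<Rightarrow> 'b::real_normed_vector \<Rightarrow> 'b) \<Rightarrow>
   ('k \<Rightarrow> 'c::real_normed_vector \<Rightarrow> 'c) \<Rightarrow> nat \<Rightarrow> nat \<Rightarrow> 'k set \<Rightarrow> ('k \<Rightarrow> 'b \<Rightarrow> 'c) \<Rightarrow> bool" where
  "k_surjective sB sC s k U L \<longleftrightarrow>
     (\<forall>y. \<exists>b :: nat \<Rightarrow> 'b. \<exists>rem :: 'k \<Rightarrow> 'c. C_on (*) sC s UNIV U rem \<and>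
        (\<forall>\<epsilon>\<in>U. L \<epsilon> (\<Sum>i\<le>k. sB (\<epsilon> ^ i) (b i)) = sC (\<epsilon> ^ k) y + sC (\<epsilon> ^ (k + 1)) (rem \<epsilon>)))"

text \<open>Internal direct sum decomposition of the whole space.\<close>

definition direct_sum ::
  "('k::real_or_complex \<Rightarrow> 'a::real_normed_vector \<Rightarrow> 'a) \<Rightarrow> nat set \<Rightarrow> (nat \<Rightarrow> 'a set) \<Rightarrow> bool" where
  "direct_sum sa I A \<longleftrightarrow>
     (\<forall>i\<in>I. module.subspace sa (A i)) \<and> (\<forall>x. \<exists>!y. y \<in> PiE I A \<and> x = (\<Sum>i\<in>I. y i))"

definition component :: "nat set \<Rightarrow> (nat \<Rightarrow> 'a::real_normed_vector set) \<Rightarrow> nat \<Rightarrow> 'a \<Rightarrow> 'a" where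
  "component I A j x = (THE y. y \<in> PiE I A \<and> x = (\<Sum>i\<in>I. y i)) j"

definition sum_space :: "nat set \<Rightarrow> (nat \<Rightarrow> 'a::real_normed_vector set) \<Rightarrow> 'a set" where
  "sum_space I A = {\<Sum>i\<in>I. y i | y. \<forall>i\<in>I. y i \<in> A i}"

text \<open>
  \<open>Nc i\<close> and \<open>R i\<close> (for \<open>i = 1, \<dots>, k+1\<close>) and \<open>N\<close> are the closed summands
  \<open>N_i^c\<close>, \<open>R_i\<close> and \<open>N_{k+1}\<close>.  In the last clause, \<open>P\<close> is the operator polynomial
  \<open>P_k(\<epsilon>)\<close>, whose lower triangularity is expressed through its blocks.
\<close>

definition splitting ::
  "('k::real_or_complex \<Rightarrow> 'b::real_normed_vector \<Rightarrow> 'b) \<Rightarrow>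
   ('k \<Rightarrow> 'c::real_normed_vector \<Rightarrow> 'c) \<Rightarrow> nat \<Rightarrow>
   (nat \<Rightarrow> 'b set) \<Rightarrow> 'b set \<Rightarrow> (nat \<Rightarrow> 'c set) \<Rightarrow> (nat \<Rightarrow> 'b \<Rightarrow> 'c) \<Rightarrow> bool" where
  "splitting sB sC k Nc N R S \<longleftrightarrow>
     direct_sum sB {1..k+2} (Nc(k+2 := N)) \<and> direct_sum sC {1..k+1} R \<and>
     closed N \<and> (\<forall>i\<in>{1..k+1}. closed (Nc i) \<and> closed (R i)) \<and>
     (\<forall>i\<in>{1..k+1}. bounded_K_linear sB sC (S i) \<and> GL_on (Nc i) (R i) (S i)) \<and>
     (\<forall>\<epsilon> :: 'k. let P = (\<lambda>x. \<Sum>i=1..k+1. sC (\<epsilon> ^ (i - 1)) (S i x)) in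
        (\<forall>x\<in>N. P x = 0) \<and>
        (\<forall>i\<in>{1..k+1}. \<forall>x\<in>Nc i.
           (\<forall>j\<in>{1..<i}. component {1..k+1} R j (P x) = 0) \<and>
           component {1..k+1} R i (P x) = sC (\<epsilon> ^ (i - 1)) (S i x)))"

text \<open>The operator polynomial \<open>p_k(\<epsilon>) = I + \<epsilon> \<phi>_1 + \<dots> + \<epsilon>^k \<phi>_k\<close> with coefficients \<open>Ph i\<close>.\<close>

definition p_poly ::
  "('k::real_or_complex \<Rightarrow> 'b::real_normed_vector \<Rightarrow> 'b) \<Rightarrow> nat \<Rightarrow> (nat \<Rightarrow> 'b \<Rightarrow> 'b) \<Rightarrow> 'k \<Rightarrow> 'b \<Rightarrow> 'b"
  where "p_poly sB k Ph \<epsilon> x = x + (\<Sum>i=1..k. sB (\<epsilon> ^ i) (Ph i x))"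

definition associated ::
  "('k::real_or_complex \<Rightarrow> 'b::real_normed_vector \<Rightarrow> 'b) \<Rightarrow>
   ('k \<Rightarrow> 'c::real_normed_vector \<Rightarrow> 'c) \<Rightarrow> nat \<Rightarrow>
   (nat \<Rightarrow> 'b set) \<Rightarrow> 'b set \<Rightarrow> (nat \<Rightarrow> 'b \<Rightarrow> 'c) \<Rightarrow> (nat \<Rightarrow> 'b \<Rightarrow> 'b) \<Rightarrow> ('k \<Rightarrow> 'b \<Rightarrow> 'c) \<Rightarrow> bool" where
  "associated sB sC k Nc N S Ph L \<longleftrightarrow>
     (\<forall>i\<in>{1..k}. bounded_K_linear sB sB (Ph i) \<and> range (Ph i) \<subseteq> sum_space {1..k+1-i} Nc) \<and>
     (\<forall>i\<le>k. \<forall>x\<in>Nc (i+1).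
        (\<lambda>\<epsilon>. norm (L \<epsilon> (p_poly sB k Ph \<epsilon> x) - sC (\<epsilon> ^ i) (S (i+1) x)))
          \<in> O[at 0](\<lambda>\<epsilon>. norm \<epsilon> ^ (i+1))) \<and>
     (\<forall>x\<in>N. (\<lambda>\<epsilon>. norm (L \<epsilon> (p_poly sB k Ph \<epsilon> x))) \<in> O[at 0](\<lambda>\<epsilon>. norm \<epsilon> ^ (k+1)))"

section \<open>The linearizing map\<close>

text \<open>
  The product \<open>N_1^c \<times> \<dots> \<times> N_{k+1}^c\<close> as a closed subspace of the bounded sequences with the
  supremum norm; entries outside \<open>1, \<dots>, k+1\<close> are zero.
\<close>

definition Nprod :: "nat \<Rightarrow> (nat \<Rightarrow> 'b::real_normed_vector set) \<Rightarrow> (nat \<Rightarrow>\<^sub>C 'b) set" where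
  "Nprod k Nc = {\<phi>. \<forall>i. apply_bcontfun \<phi> i \<in> (if i \<in> {1..k+1} then Nc i else {0})}"

definition row_op ::
  "nat \<Rightarrow> (nat \<Rightarrow> 'b::real_normed_vector \<Rightarrow> 'c::real_normed_vector) \<Rightarrow> (nat \<Rightarrow>\<^sub>C 'b) \<Rightarrow> 'c" where
  "row_op k S \<phi> = (\<Sum>i=1..k+1. S i (apply_bcontfun \<phi> i))"

definition Vball ::
  "nat \<Rightarrow> (nat \<Rightarrow> 'b::real_normed_vector set) \<Rightarrow> 'b set \<Rightarrow> real \<Rightarrow> ((nat \<Rightarrow>\<^sub>C 'b) \<times> 'b) set" where
  "Vball k Nc N \<rho> = {w \<in> Nprod k Nc \<times> N. norm w < \<rho>}"

text \<open>The parametrization of the generalized cone.\<close>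

definition cone_map ::
  "('k::real_or_complex \<Rightarrow> 'b::real_normed_vector \<Rightarrow> 'b) \<Rightarrow> nat \<Rightarrow> (nat \<Rightarrow> 'b \<Rightarrow> 'b) \<Rightarrow> ('k \<Rightarrow> 'b) \<Rightarrow>
   ('k \<times> (nat \<Rightarrow>\<^sub>C 'b) \<times> 'b \<Rightarrow> 'b) \<Rightarrow> 'k \<Rightarrow> (nat \<Rightarrow>\<^sub>C 'b) \<times> 'b \<Rightarrow> 'b" where
  "cone_map sB k Ph z \<Psi> \<epsilon> w =
     z \<epsilon> + sB (\<epsilon> ^ k) (p_poly sB k Ph \<epsilon> (\<Psi> (\<epsilon>, fst w, snd w) + snd w))"

text \<open>
  \<open>chi i\<close> takes values in the bounded bilinear operators from \<open>N_{k+1} \<times> N_{k+1}^c\<close> to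
  \<open>N_i^c\<close>, represented by their extensions to the whole product space (the subspaces are
  complemented, so such extensions exist and can be chosen to depend linearly on the operator).
\<close>

definition linearizing_map ::
  "('k::real_or_complex \<Rightarrow> 'b::real_normed_vector \<Rightarrow> 'b) \<Rightarrow>
   ('k \<Rightarrow> 'c::real_normed_vector \<Rightarrow> 'c) \<Rightarrow> nat \<Rightarrow> nat \<Rightarrow>
   (nat \<Rightarrow> 'b set) \<Rightarrow> 'b set \<Rightarrow> (nat \<Rightarrow> 'b \<Rightarrow> 'c) \<Rightarrow> (nat \<Rightarrow> 'b \<Rightarrow> 'b) \<Rightarrow>
   ('b \<Rightarrow> 'c) \<Rightarrow> ('k \<Rightarrow> 'b) \<Rightarrow> 'k set \<Rightarrow> real \<Rightarrow> ('k \<times> (nat \<Rightarrow>\<^sub>C 'b) \<times> 'b \<Rightarrow> 'b) \<Rightarrow> bool" where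
  "linearizing_map sB sC s k Nc N S Ph G z U \<rho> \<Psi> \<longleftrightarrow>
     (let V = Vball k Nc N \<rho>;
          sV = scale_prod (scale_seq sB) sB;
          smooth_UV = C_on (scale_prod (*) sV) sB s (UNIV \<times> Nprod k Nc \<times> N) (U \<times> V) in
      smooth_UV \<Psi> \<and>
      (\<exists>(\<psi> :: nat \<Rightarrow> 'k \<times> (nat \<Rightarrow>\<^sub>C 'b) \<times> 'b \<Rightarrow> 'b)
         (chi :: nat \<Rightarrow> 'b \<times> 'b \<Rightarrow> (('b \<times> 'b) \<Rightarrow>\<^sub>L (('b \<times> 'b) \<Rightarrow>\<^sub>L 'b))).
         (\<forall>\<epsilon>\<in>U. \<forall>w\<in>V. \<Psi> (\<epsilon>, w) = (\<Sum>i=1..k+1. sB (\<epsilon> ^ (k + 1 - i)) (\<psi> i (\<epsilon>, w)))) \<and>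
         (\<forall>i\<in>{1..k+1}.
            smooth_UV (\<psi> i) \<and> \<psi> i ` (U \<times> V) \<subseteq> Nc i \<and> (\<forall>\<epsilon>\<in>U. \<psi> i (\<epsilon>, 0, 0) = 0) \<and>
            C_on (scale_prod sB sB) (scale_blinfun (scale_blinfun sB)) s
              (N \<times> Nc (k+1)) {x \<in> N \<times> Nc (k+1). norm x < \<rho>} (chi i) \<and>
            (\<forall>x \<in> N \<times> Nc (k+1). norm x < \<rho> \<longrightarrow>
               (\<forall>u. bounded_K_linear (scale_prod sB sB) sB (\<lambda>v. blinfun_apply (blinfun_apply (chi i x) u) v)) \<and>
               (\<forall>v. bounded_K_linear (scale_prod sB sB) sB (\<lambda>u. blinfun_apply (blinfun_apply (chi i x) u) v)) \<and>
               (\<forall>u v. blinfun_apply (blinfun_apply (chi i x) u) v \<in> Nc i)) \<and>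
            (\<forall>\<phi> n. (\<phi>, n) \<in> V \<longrightarrow>
               (let x = (n, apply_bcontfun \<phi> (k+1)) in
                \<psi> i (0, \<phi>, n) =
                  apply_bcontfun \<phi> i + blinfun_apply (blinfun_apply (chi i x) x) x)))) \<and>
      (\<forall>\<epsilon>\<in>U. \<forall>w\<in>V. G (cone_map sB k Ph z \<Psi> \<epsilon> w) =
         G (z \<epsilon>) + sC (\<epsilon> ^ (2 * k)) (row_op k S (fst w))) \<and>
      (\<forall>\<epsilon>\<in>U - {0}. C_diffeo_onto_nbhd sV sB s (Nprod k Nc \<times> N) V
         (cone_map sB k Ph z \<Psi> \<epsilon>) (z \<epsilon>)))"

end

theory Submission
  imports Defs
begin

text \<open>
  The row operator \<open>T = (S\<^sub>1 \<dots> S\<^sub>k\<^sub>+\<^sub>1)\<close> is a bounded bijection from the complete space \<open>N\<^sup>c\<close> onto the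
  target space, so by the open mapping theorem its inverse is bounded and \<open>\<phi>\<^sub>0(\<epsilon>)\<close> stays well
  inside \<open>V\<close> when \<open>b(0)\<close> is small.  The rest is read off from the linearized identity: in the
  cone, \<open>G = \<epsilon>\<^sup>2\<^sup>k (b + T \<phi>)\<close> vanishes iff \<open>T \<phi> = - b\<close>, whereas for a residual of order \<open>q < 2k\<close>
  it is \<open>\<epsilon>\<^sup>q (b + \<epsilon>\<^sup>2\<^sup>k\<^sup>-\<^sup>q T \<phi>)\<close>, where \<open>b\<close> dominates because \<open>T\<close> is bounded on \<open>V\<close>.
\<close>

section \<open>Open mapping theorem on a complete subspace\<close>

text \<open>By Baire, the closure of the image of some ball of \<open>X\<close> has an interior
  point; convexity and symmetry move the interior to a ball around 0, and scaling reaches every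
  \<open>y\<close>. Only closures of images are controlled, hence a preimage up to half the
  norm.\<close>

lemma open_mapping_approx:
  fixes T :: "'a::real_normed_vector \<Rightarrow> 'b::banach"
  assumes T: "bounded_linear T" and X: "subspace X" and surj: "T ` X = UNIV"
  shows "\<exists>c\<ge>0. \<forall>y. \<exists>x\<in>X. norm x \<le> c * norm y \<and> norm (y - T x) \<le> norm y / 2"
proof -
  interpret T: bounded_linear T by fact
  define F where "F n = closure (T ` (X \<inter> cball 0 (real n)))" for n
  \<comment> \<open>Baire: the closed sets \<open>F n\<close> cover the complete target space.\<close>
  have "\<exists>n. interior (F n) \<noteq> {}"
  proof (rule ccontr)
    assume "\<not> (\<exists>n. interior (F n) \<noteq> {})"
    then have "euclidean interior_of (\<Union>(range F)) = {}"
      by (intro Met_TC.metric_Baire_category_alt[unfolded mtopology_is_euclidean])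
         (auto simp: mcomplete_iff_complete complete_UNIV F_def)
    moreover have "y \<in> \<Union>(range F)" for y
    proof -
      obtain x where x: "x \<in> X" "y = T x" using surj by (metis UNIV_I imageE)
      obtain n :: nat where "norm x \<le> n" using real_arch_simple by blast
      then have "y \<in> T ` (X \<inter> cball 0 (real n))" using x by simp
      then have "y \<in> F n" unfolding F_def by (rule closure_subset[THEN subsetD])
      then show ?thesis by (rule UN_I[OF UNIV_I])
    qed
    then have "\<Union>(range F) = UNIV" by (intro UNIV_eq_I[symmetric])
    ultimately show False by simp
  qed
  then obtain n y0 where "y0 \<in> interior (F n)" by blast
  then obtain e where e: "e > 0" "ball y0 e \<subseteq> F n"
    by (metis mem_interior)
  have cv: "convex (F n)"
  proof -
    have "convex (X \<inter> cball 0 (real n))"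
      by (rule convex_Int[OF subspace_imp_convex[OF X] convex_cball])
    then show ?thesis
      unfolding F_def by (rule convex_closure[OF convex_linear_image[OF bounded_linear.linear[OF T]]])
  qed
  have sym: "- y \<in> F n" if y: "y \<in> F n" for y
    unfolding F_def closure_approachable
  proof (intro allI impI)
    fix e :: real assume "e > 0"
    then obtain w where "w \<in> T ` (X \<inter> cball 0 (real n))" "dist w y < e"
      using y unfolding F_def closure_approachable by blast
    then obtain x where x: "x \<in> X" "norm x \<le> n" "dist (T x) y < e" by auto
    then have "T (- x) \<in> T ` (X \<inter> cball 0 (real n))"
      by (intro imageI IntI subspace_neg[OF X]) simp_all
    moreover have "dist (T (- x)) (- y) < e"
      using x(3) by (simp add: T.neg dist_minus)
    ultimately show "\<exists>w\<in>T ` (X \<inter> cball 0 (real n)). dist w (- y) < e" by blast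
  qed
  \<comment> \<open>Such a \<open>y\<close> is the midpoint of \<open>y0 + y\<close> and
    \<open>- (y0 - y)\<close>; the first lies in the ball around \<open>y0\<close>, the second is
    the reflection of a point of that ball.\<close>
  have small: "y \<in> F n" if "norm y < e" for y
  proof -
    have "y0 + y \<in> F n" "y0 - y \<in> F n"
      using e(2) that by (auto simp: subset_iff dist_norm)
    then have "(1/2) *\<^sub>R (y0 + y) + (1/2) *\<^sub>R (- (y0 - y)) \<in> F n"
      by (intro convexD[OF cv] sym) auto
    moreover have "(1/2) *\<^sub>R (y0 + y) + (1/2) *\<^sub>R (- (y0 - y)) = y"
      by (simp add: algebra_simps flip: scaleR_left_distrib)
    ultimately show ?thesis by simp
  qed
  \<comment> \<open>A nonzero \<open>y\<close> is scaled by \<open>t\<close> to norm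
    \<open>e / 2\<close> and approximated within \<open>e / 4\<close> by some \<open>T x\<close>
    with \<open>norm x \<le> n\<close>. Dividing by \<open>t = e / (2 * norm y)\<close> turns these
    bounds into \<open>norm y / 2\<close> and \<open>c * norm y\<close>.\<close>
  define c where "c = 2 * real n / e"
  have "\<exists>x\<in>X. norm x \<le> c * norm y \<and> norm (y - T x) \<le> norm y / 2" for y
  proof (cases "y = 0")
    case True
    then show ?thesis using subspace_0[OF X] by (intro bexI[of _ 0]) (auto simp: T.zero)
  next
    case False
    define t where "t = e / (2 * norm y)"
    have t: "t > 0" "t * norm y = e / 2" using False e(1) by (auto simp: t_def)
    then have "t *\<^sub>R y \<in> F n" using e(1) by (intro small) auto
    moreover have "e / 4 > 0" using e(1) by simp
    ultimately obtain w where "w \<in> T ` (X \<inter> cball 0 (real n))" "dist w (t *\<^sub>R y) < e / 4"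
      unfolding F_def closure_approachable by blast
    then obtain x where x: "x \<in> X" "norm x \<le> n" and d: "norm (t *\<^sub>R y - T x) < e / 4"
      by (auto simp: dist_norm norm_minus_commute)
    have "y - T (x /\<^sub>R t) = (t *\<^sub>R y - T x) /\<^sub>R t"
      using t by (simp add: T.scaleR algebra_simps)
    then have "norm (y - T (x /\<^sub>R t)) \<le> e / 4 / t"
      using d t by (simp add: divide_simps)
    also have "e / 4 / t = norm y / 2" using e(1) False by (simp add: t_def)
    finally have "norm (y - T (x /\<^sub>R t)) \<le> norm y / 2" .
    moreover have "norm (x /\<^sub>R t) \<le> n / t" using x t by (simp add: divide_simps)
    then have "norm (x /\<^sub>R t) \<le> c * norm y" using e(1) by (simp add: t_def c_def field_simps)
    ultimately show ?thesis using subspace_scale[OF X x(1)] by blast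
  qed
  moreover have "c \<ge> 0" using e(1) by (simp add: c_def)
  ultimately show ?thesis by blast
qed

text \<open>Solving approximately again for the residual halves it each time, so the corrections are
  dominated by a geometric series and sum up in \<open>X\<close> by completeness. The domain is a
  subspace because \<open>N\<^sup>c\<close> is realized inside the bounded sequences.\<close>

theorem open_mapping_bounded_preimage:
  fixes T :: "'a::real_normed_vector \<Rightarrow> 'b::banach"
  assumes T: "bounded_linear T" and X: "subspace X" "complete X" and surj: "T ` X = UNIV"
  shows "\<exists>M>0. \<forall>y. \<exists>x\<in>X. T x = y \<and> norm x \<le> M * norm y"
proof -
  interpret T: bounded_linear T by fact
  obtain c where "c \<ge> 0" and "\<forall>y. \<exists>x\<in>X. norm x \<le> c * norm y \<and> norm (y - T x) \<le> norm y / 2"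
    using open_mapping_approx[OF T X(1) surj] by blast
  then obtain g where gX: "g y \<in> X" and g: "norm (g y) \<le> c * norm y"
    and rest: "norm (y - T (g y)) \<le> norm y / 2" for y
    by metis
  \<comment> \<open>The series contributes \<open>2 * c\<close>; the added 1 makes the constant
    strictly positive, so that it can serve as a divisor.\<close>
  have "\<exists>x\<in>X. T x = y \<and> norm x \<le> (2 * c + 1) * norm y" for y
  proof -
    \<comment> \<open>\<open>r m\<close> is the residual after \<open>m\<close> rounds of successive approximation.\<close>
    define r where "r m = ((\<lambda>y. y - T (g y)) ^^ m) y" for m
    have r_Suc: "r (Suc m) = r m - T (g (r m))" for m by (simp add: r_def)
    have r: "norm (r m) \<le> norm y * (1/2) ^ m" for m
    proof (induction m)
      case (Suc m)
      then show ?case using rest[of "r m"] by (simp add: r_Suc)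
    qed (simp add: r_def)
    have gr: "norm (g (r m)) \<le> c * norm y * (1/2) ^ m" for m
      using g[of "r m"] mult_left_mono[OF r \<open>c \<ge> 0\<close>, of m] by (simp add: mult.assoc)
    have geo: "(\<lambda>m. c * norm y * (1/2) ^ m) sums (c * norm y * 2)"
      using sums_mult[OF geometric_sums[of "1/2::real"]] by simp
    have part: "norm (\<Sum>m\<in>A. g (r m)) \<le> (\<Sum>m\<in>A. c * norm y * (1/2) ^ m)" for A
      by (rule sum_norm_le) (rule gr)
    define s where "s n = (\<Sum>m<n. g (r m))" for n
    have "s n \<in> X" for n unfolding s_def using X(1) gX by (rule subspace_sum)
    moreover have "Cauchy s"
    proof (rule CauchyI')
      fix e :: real assume "e > 0"
      then obtain m0 where m0: "\<forall>m\<ge>m0. \<forall>n. norm (\<Sum>i=m..<n. c * norm y * (1/2) ^ i) < e"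
        using sums_summable[OF geo] unfolding summable_Cauchy by blast
      have "dist (s m) (s n) < e" if "m \<ge> m0" "n > m" for m n
      proof -
        have "s n - s m = (\<Sum>i=m..<n. g (r i))"
          unfolding s_def using that sum_diff_nat_ivl[of 0 m n "\<lambda>i. g (r i)"]
          by (simp add: atLeast0LessThan)
        then have "dist (s m) (s n) = norm (\<Sum>i=m..<n. g (r i))"
          by (metis dist_commute dist_norm)
        then show ?thesis using part[of "{m..<n}"] m0[rule_format, of m n] that by simp
      qed
      then show "\<exists>m0. \<forall>m\<ge>m0. \<forall>n>m. dist (s m) (s n) < e" by blast
    qed
    ultimately obtain x where "x \<in> X" and lim: "s \<longlonglongrightarrow> x"
      using X(2) unfolding complete_def by blast
    moreover have "T x = y"
    proof (rule LIMSEQ_unique[OF T.tendsto[OF lim]])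
      \<comment> \<open>The sum telescopes, since \<open>T (g (r m))\<close> is exactly the drop
        from \<open>r m\<close> to \<open>r (Suc m)\<close>.\<close>
      have "T (s n) = y - r n" for n
        by (induction n) (simp_all add: s_def T.zero T.add r_Suc, simp add: r_def)
      moreover have "r \<longlonglongrightarrow> 0"
      proof (rule Lim_null_comparison)
        show "(\<lambda>m. norm y * (1/2) ^ m) \<longlonglongrightarrow> 0"
          by (intro tendsto_mult_right_zero LIMSEQ_power_zero) simp
      qed (use r in simp)
      then have "(\<lambda>n. y - r n) \<longlonglongrightarrow> y - 0" by (intro tendsto_diff tendsto_const)
      ultimately show "(\<lambda>n. T (s n)) \<longlonglongrightarrow> y" by simp
    qed
    moreover have "norm x \<le> (2 * c + 1) * norm y"
    proof -
      have "norm (s n) \<le> c * norm y * 2" for n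
        using part[of "{..<n}"] sum_le_suminf[OF sums_summable[OF geo], of "{..<n}"] \<open>c \<ge> 0\<close>
        unfolding s_def sums_unique[OF geo, symmetric] by simp
      then have "norm x \<le> c * norm y * 2"
        by (intro LIMSEQ_le_const2[OF tendsto_norm[OF lim]]) blast
      also have "\<dots> \<le> (2 * c + 1) * norm y" by (simp add: algebra_simps)
      finally show ?thesis .
    qed
    ultimately show ?thesis by blast
  qed
  then show ?thesis using \<open>c \<ge> 0\<close> by (intro exI[of _ "2 * c + 1"]) auto
qed

section \<open>The product of the complements and its row operator\<close>

text \<open>A Cauchy sequence in the supremum norm converges uniformly, and its limit is again a
  bounded continuous function. Evaluation at each index preserves the limit, so closedness of the
  factors, including \<open>{0}\<close> off the index range, puts the limit back into the
  product.\<close>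

lemma complete_Nprod:
  fixes Nc :: "nat \<Rightarrow> 'b::banach set"
  assumes "\<forall>i\<in>{1..k+1}. closed (Nc i)"
  shows "complete (Nprod k Nc)"
  unfolding complete_def
proof (intro allI impI, elim conjE)
  fix f :: "nat \<Rightarrow> nat \<Rightarrow>\<^sub>C 'b"
  assume fN: "\<forall>n. f n \<in> Nprod k Nc" and "Cauchy f"
  then obtain g where "uniform_limit UNIV f g sequentially"
    using uniformly_convergent_eq_cauchy[of "\<lambda>_. True" f]
    unfolding Cauchy_def uniform_limit_sequentially_iff
    by (metis dist_fun_lt_imp_dist_val_lt)
  from uniform_limit_bcontfunE[OF this sequentially_bot]
  obtain l where l: "f \<longlonglongrightarrow> l" by metis
  have "apply_bcontfun l i \<in> (if i \<in> {1..k+1} then Nc i else {0})" for i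
  proof (rule closed_sequentially)
    show "(\<lambda>n. apply_bcontfun (f n) i) \<longlonglongrightarrow> apply_bcontfun l i"
      using tendsto_bcontfun_uniform_limit[OF l] by (rule tendsto_uniform_limitI) simp
    show "closed (if i \<in> {1..k+1} then Nc i else {0})" using assms by auto
    show "apply_bcontfun (f n) i \<in> (if i \<in> {1..k+1} then Nc i else {0})" for n
      using fN unfolding Nprod_def by blast
  qed
  then show "\<exists>l\<in>Nprod k Nc. f \<longlonglongrightarrow> l" using l unfolding Nprod_def by blast
qed

lemma subspace_Nprod:
  assumes "\<forall>i\<in>{1..k+1}. subspace (Nc i)"
  shows "subspace (Nprod k Nc)"
  using assms unfolding subspace_def Nprod_def by auto

text \<open>Real scalars act through \<open>of_real\<close>. This passes from subspaces over the
  field to the real ones required by the convexity and open mapping arguments.\<close>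

lemma (in K_normed_space) subspace_imp_real_subspace:
  assumes "module.subspace scale A"
  shows "Real_Vector_Spaces.subspace A"
  using assms unfolding subspace_def Real_Vector_Spaces.subspace_def by (metis scale_of_real)

lemma bounded_linear_row_op:
  assumes "\<forall>i\<in>{1..k+1}. bounded_linear (S i)"
  shows "bounded_linear (row_op k S)"
proof -
  have app: "bounded_linear (\<lambda>\<phi>. apply_bcontfun \<phi> i)" for i :: nat
    by (rule bounded_linear_intro[where K = 1]) (auto simp: norm_bounded)
  have "bounded_linear (\<lambda>\<phi>. \<Sum>i=1..k+1. S i (apply_bcontfun \<phi> i))"
    using assms by (intro bounded_linear_sum bounded_linear_compose[OF _ app]) auto
  then show ?thesis unfolding row_op_def .
qed

text \<open>The summand \<open>S i (\<phi> i)\<close> is the component of the image in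
  \<open>R i\<close>. Uniqueness of components together with injectivity of each \<open>S i\<close>
  gives injectivity; existence of components together with surjectivity of each \<open>S i\<close>
  gives surjectivity.\<close>

lemma bij_betw_row_op:
  fixes S :: "nat \<Rightarrow> 'b::real_normed_vector \<Rightarrow> 'c::real_normed_vector"
  assumes R: "direct_sum sC {1..k+1} R" and S: "\<forall>i\<in>{1..k+1}. bij_betw (S i) (Nc i) (R i)"
  shows "bij_betw (row_op k S) (Nprod k Nc) UNIV"
proof -
  let ?I = "{1..k+1}"
  have ex: "\<exists>y. y \<in> PiE ?I R \<and> x = (\<Sum>i\<in>?I. y i)" for x
    using R unfolding direct_sum_def by blast
  have uniq: "y = y'" if "y \<in> PiE ?I R" "y' \<in> PiE ?I R" "(\<Sum>i\<in>?I. y i) = (\<Sum>i\<in>?I. y' i)" for y y'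
    using R that unfolding direct_sum_def by metis
  have SR: "S i v \<in> R i" if "i \<in> ?I" "v \<in> Nc i" for i v
    using S that by (meson bij_betw_apply)
  have "inj_on (row_op k S) (Nprod k Nc)"
  proof (rule inj_onI)
    fix \<phi> \<phi>' assume \<phi>: "\<phi> \<in> Nprod k Nc" "\<phi>' \<in> Nprod k Nc" "row_op k S \<phi> = row_op k S \<phi>'"
    have N: "apply_bcontfun \<phi> i \<in> Nc i" "apply_bcontfun \<phi>' i \<in> Nc i" if "i \<in> ?I" for i
      using \<phi>(1,2) that unfolding Nprod_def by (metis (mono_tags, lifting) mem_Collect_eq)+
    \<comment> \<open>Both families are restricted to \<open>?I\<close> because members of
      \<open>PiE\<close> must be \<open>undefined\<close> elsewhere.\<close>
    have eq: "(\<lambda>i\<in>?I. S i (apply_bcontfun \<phi> i)) = (\<lambda>i\<in>?I. S i (apply_bcontfun \<phi>' i))"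
      using N SR \<phi>(3)
      by (intro uniq) (simp_all add: row_op_def restrict_PiE_iff del: One_nat_def)
    have "apply_bcontfun \<phi> i = apply_bcontfun \<phi>' i" if i: "i \<in> ?I" for i
    proof (rule inj_onD)
      show "inj_on (S i) (Nc i)" using S i by (blast dest: bij_betw_imp_inj_on)
      show "S i (apply_bcontfun \<phi> i) = S i (apply_bcontfun \<phi>' i)"
        using fun_cong[OF eq, of i] i by (simp only: restrict_apply')
    qed (use N i in blast)+
    moreover have "apply_bcontfun \<phi> i = apply_bcontfun \<phi>' i" if "i \<notin> ?I" for i
    proof -
      have "apply_bcontfun \<phi> i \<in> (if i \<in> ?I then Nc i else {0})"
        "apply_bcontfun \<phi>' i \<in> (if i \<in> ?I then Nc i else {0})"
        using \<phi>(1,2) unfolding Nprod_def by blast+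
      then show ?thesis unfolding if_not_P[OF that] by simp
    qed
    ultimately show "\<phi> = \<phi>'" by (intro bcontfun_eqI) blast
  qed
  moreover have "x \<in> row_op k S ` Nprod k Nc" for x
  proof -
    obtain y where y: "y \<in> PiE ?I R" "x = (\<Sum>i\<in>?I. y i)" using ex by blast
    define f where "f i = (if i \<in> ?I then the_inv_into (Nc i) (S i) (y i) else 0)" for i
    have f: "f i \<in> Nc i" "S i (f i) = y i" if "i \<in> ?I" for i
    proof -
      have "bij_betw (S i) (Nc i) (R i)" using S that by blast
      moreover have "y i \<in> R i" using y(1) that by (rule PiE_mem)
      ultimately have "y i \<in> S i ` Nc i" "inj_on (S i) (Nc i)" by (simp_all add: bij_betw_def)
      then show "f i \<in> Nc i" "S i (f i) = y i"
        using that by (auto simp: f_def the_inv_into_into f_the_inv_into_f simp del: One_nat_def)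
    qed
    \<comment> \<open>A finite range makes \<open>f\<close> bounded, and continuity is automatic on
      the discrete space \<open>nat\<close>; hence \<open>f\<close> is the value function of an
      element of the sequence space.\<close>
    have "range f \<subseteq> insert 0 (f ` ?I)" by (auto simp: f_def)
    then have "finite (range f)" by (rule finite_subset) simp
    then have "f \<in> bcontfun" by (simp add: bcontfun_def finite_imp_bounded)
    then have app: "apply_bcontfun (Bcontfun f) = f" by (rule Bcontfun_inverse)
    have "Bcontfun f \<in> Nprod k Nc" using f(1) by (auto simp: Nprod_def app) (auto simp: f_def)
    moreover have "row_op k S (Bcontfun f) = x"
      unfolding row_op_def app y(2) using f(2) by (intro sum.cong) auto
    ultimately show ?thesis by blast
  qed
  ultimately show ?thesis unfolding bij_betw_def by blast
qed

section \<open>Continuity of smooth families\<close>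

lemma C_on_imp_continuous_on:
  fixes f :: "'a::real_normed_vector \<Rightarrow> 'b::real_normed_vector"
  assumes "C_on sa sb r UNIV S f"
  shows "continuous_on S f"
proof -
  obtain D :: "nat \<Rightarrow> 'a \<Rightarrow> 'a list \<Rightarrow> 'b" where D0: "\<forall>x\<in>S. D 0 x [] = f x"
    and c: "\<forall>n\<le>r. \<forall>x\<in>S. \<forall>e>0. \<exists>d>0. \<forall>y\<in>S. dist y x < d \<longrightarrow>
       (\<forall>vs. set vs \<subseteq> UNIV \<and> length vs = n \<longrightarrow> norm (D n y vs - D n x vs) \<le> e * prod_list (map norm vs))"
    using assms unfolding C_on_def by (elim conjE exE) (rule that; assumption)
  show ?thesis
    unfolding continuous_on_iff
  proof (intro ballI allI impI)
    fix x and e :: real assume x: "x \<in> S" "e > 0"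
    \<comment> \<open>At order 0 the only argument list is empty and its product of norms is 1.
      Taking \<open>e / 2\<close> turns the weak estimate into a strict one.\<close>
    then obtain d where "d > 0" and d: "\<forall>y\<in>S. dist y x < d \<longrightarrow>
       (\<forall>vs. set vs \<subseteq> UNIV \<and> length vs = 0 \<longrightarrow> norm (D 0 y vs - D 0 x vs) \<le> e / 2 * prod_list (map norm vs))"
      using c[rule_format, of 0 x "e/2"] by auto
    have "dist (f y) (f x) < e" if "y \<in> S" "dist y x < d" for y
      using bspec[OF d that(1)] that(2) D0 x that(1) by (simp add: dist_norm)
    then show "\<exists>d>0. \<forall>y\<in>S. dist y x < d \<longrightarrow> dist (f y) (f x) < e" using \<open>d > 0\<close> by blast
  qed
qed

section \<open>Zeros in the generalized cone\<close>

text \<open>Quantifying \<open>\<delta>\<close> before \<open>G\<close>, \<open>z\<close> and the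
  linearizing map renders the smallness of \<open>b 0\<close> as a bound determined by the splitting
  and \<open>\<rho>\<close> alone. The set \<open>U'\<close> is the shrunk parameter neighbourhood
  and may depend on \<open>b\<close>.\<close>

theorem corollary1:
  fixes sB :: "'k::real_or_complex \<Rightarrow> 'b::banach \<Rightarrow> 'b"
    and sC :: "'k \<Rightarrow> 'c::banach \<Rightarrow> 'c"
    and k :: nat
    and Nc :: "nat \<Rightarrow> 'b set" and N :: "'b set" and R :: "nat \<Rightarrow> 'c set"
    and S :: "nat \<Rightarrow> 'b \<Rightarrow> 'c"
    and \<rho> :: real
  assumes "K_normed_space sB" and "K_normed_space sC"
    and "splitting sB sC k Nc N R S"
    and "\<rho> > 0"
  shows "\<exists>\<delta>>0. \<forall>(r::nat) (s::nat) (U :: 'k set) (G :: 'b \<Rightarrow> 'c) (z :: 'k \<Rightarrow> 'b)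
      (Ph :: nat \<Rightarrow> 'b \<Rightarrow> 'b) (\<Psi> :: 'k \<times> (nat \<Rightarrow>\<^sub>C 'b) \<times> 'b \<Rightarrow> 'b).
    let L = (\<lambda>\<epsilon>. frechet_derivative G (at (z \<epsilon>)));
        V = Vball k Nc N \<rho>;
        cone = cone_map sB k Ph z \<Psi>
    in
      r \<ge> 2 \<and> s \<ge> 1 \<and> open U \<and> 0 \<in> U \<and>
      C_on sB sC r UNIV UNIV G \<and> C_on (*) sB r UNIV U z \<and> z 0 = 0 \<and>
      k_surjective sB sC s k U L \<and>
      associated sB sC k Nc N S Ph L \<and>
      linearizing_map sB sC s k Nc N S Ph G z U \<rho> \<Psi> \<longrightarrow>
      (\<forall>b :: 'k \<Rightarrow> 'c.
         C_on (*) sC s UNIV U b \<and> (\<forall>\<epsilon>\<in>U. G (z \<epsilon>) = sC (\<epsilon> ^ (2 * k)) (b \<epsilon>)) \<and> norm (b 0) < \<delta> \<longrightarrow>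
         (let \<phi>0 = (\<lambda>\<epsilon>. - the_inv_into (Nprod k Nc) (row_op k S) (b \<epsilon>)) in
          \<exists>U'\<subseteq>U. open U' \<and> 0 \<in> U' \<and>
            (\<forall>\<epsilon>\<in>U'. \<phi>0 \<epsilon> \<in> Nprod k Nc) \<and>
            (\<exists>\<sigma>>0. \<forall>\<epsilon>\<in>U'. \<forall>\<phi>\<in>Nprod k Nc. \<forall>n\<in>N. norm \<phi> < \<sigma> \<and> norm n < \<sigma> \<longrightarrow>
               (\<phi> + \<phi>0 \<epsilon>, n) \<in> V \<and>
               G (cone \<epsilon> (\<phi> + \<phi>0 \<epsilon>, n)) = sC (\<epsilon> ^ (2 * k)) (row_op k S \<phi>)) \<and>
            (\<forall>\<epsilon>\<in>U' - {0}.
               {x \<in> cone \<epsilon> ` V. G x = 0} = {cone \<epsilon> (\<phi>0 \<epsilon>, n) | n. (\<phi>0 \<epsilon>, n) \<in> V}))) \<and>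
      (k \<ge> 1 \<longrightarrow>
         (\<forall>(q::nat) (b :: 'k \<Rightarrow> 'c).
            q \<le> 2 * k - 1 \<and> C_on (*) sC s UNIV U b \<and>
            (\<forall>\<epsilon>\<in>U. G (z \<epsilon>) = sC (\<epsilon> ^ q) (b \<epsilon>)) \<and> b 0 \<noteq> 0 \<longrightarrow>
            (\<exists>U'\<subseteq>U. open U' \<and> 0 \<in> U' \<and>
               (\<forall>\<epsilon>\<in>U' - {0}. \<forall>x \<in> cone \<epsilon> ` V. G x \<noteq> 0))))"
proof -
  interpret B: K_normed_space sB by fact
  interpret C: K_normed_space sC by fact
  define T where "T = row_op k S"
  define X where "X = Nprod k Nc"
  have dsB: "direct_sum sB {1..k+2} (Nc(k+2 := N))" and dsC: "direct_sum sC {1..k+1} R"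
    and clo: "\<forall>i\<in>{1..k+1}. closed (Nc i)"
    and bl: "\<forall>i\<in>{1..k+1}. bounded_linear (S i)"
    and bij: "\<forall>i\<in>{1..k+1}. bij_betw (S i) (Nc i) (R i)"
    using assms(3) unfolding splitting_def bounded_K_linear_def GL_on_def by blast+
  \<comment> \<open>The update that installs \<open>N\<close> at index \<open>k+2\<close> leaves the
    indices up to \<open>k+1\<close> untouched.\<close>
  have "B.subspace (Nc i)" if "i \<in> {1..k+1}" for i
  proof -
    have "\<forall>i\<in>{1..k+2}. B.subspace ((Nc(k+2 := N)) i)" using dsB unfolding direct_sum_def by blast
    from bspec[OF this, of i] show ?thesis using that by simp
  qed
  then have X: "subspace X"
    unfolding X_def by (intro subspace_Nprod ballI B.subspace_imp_real_subspace)
  have blT: "bounded_linear T" unfolding T_def by (rule bounded_linear_row_op[OF bl])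
  interpret T: bounded_linear T by fact
  have bijT: "bij_betw T X UNIV" unfolding T_def X_def by (rule bij_betw_row_op[OF dsC bij])
  then have injT: "inj_on T X" and surjT: "T ` X = UNIV" by (auto simp: bij_betw_def)
  define inv where "inv = the_inv_into X T"
  have invX: "inv y \<in> X" and T_inv: "T (inv y) = y" for y
    unfolding inv_def using injT surjT by (auto intro!: the_inv_into_into f_the_inv_into_f)
  have inv_T: "inv (T x) = x" if "x \<in> X" for x
    unfolding inv_def using injT that by (rule the_inv_into_f_f)
  obtain M where "M > 0" and "\<forall>y. \<exists>x\<in>X. T x = y \<and> norm x \<le> M * norm y"
    using open_mapping_bounded_preimage[OF blT X _ surjT] complete_Nprod[OF clo]
    unfolding X_def[symmetric] by blast
  \<comment> \<open>Injectivity identifies the bounded preimage found above with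
    \<open>inv y\<close>.\<close>
  then have M: "norm (inv y) \<le> M * norm y" for y using inv_T by metis
  obtain K where "K > 0" and K: "norm (T x) \<le> norm x * K" for x
    using T.pos_bounded by blast

  \<comment> \<open>With this choice the shift has norm below \<open>\<rho> / 2\<close>, and the
    other half of the radius of \<open>V\<close> is shared by \<open>\<phi>\<close> and
    \<open>n\<close>, a quarter of \<open>\<rho>\<close> each.\<close>
  define \<delta> where "\<delta> = \<rho> / (2 * M)"
  have "\<delta> > 0" using \<open>M > 0\<close> \<open>\<rho> > 0\<close> by (simp add: \<delta>_def)
  have sublevel: "open {\<epsilon>\<in>U. P (b \<epsilon>)}" if "open U" "C_on (*) sC s UNIV U b" "open {y. P y}"
    for U s b and P :: "'c \<Rightarrow> bool"
    using continuous_open_preimage[OF C_on_imp_continuous_on[OF that(2)] that(1,3)]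
    by (simp add: vimage_def Int_def)

  show ?thesis
    unfolding Let_def X_def[symmetric] T_def[symmetric] inv_def[symmetric]
  proof (intro exI[of _ \<delta>] conjI \<open>\<delta> > 0\<close> allI impI; (elim conjE)?)

    \<comment> \<open>Residual of order 2k: absorption by a shift\<close>
    fix r s :: nat and U :: "'k set" and G z Ph \<Psi> and b :: "'k \<Rightarrow> 'c"
    assume U: "open U" "0 \<in> U" and lin: "linearizing_map sB sC s k Nc N S Ph G z U \<rho> \<Psi>"
      and b: "C_on (*) sC s UNIV U b" "norm (b 0) < \<delta>"
      and Gz: "\<forall>\<epsilon>\<in>U. G (z \<epsilon>) = sC (\<epsilon> ^ (2 * k)) (b \<epsilon>)"
    let ?V = "Vball k Nc N \<rho>" and ?cone = "cone_map sB k Ph z \<Psi>"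
    have cone: "G (?cone \<epsilon> w) = sC (\<epsilon> ^ (2 * k)) (b \<epsilon> + T (fst w))" if "\<epsilon> \<in> U" "w \<in> ?V" for \<epsilon> w
      using lin Gz that unfolding linearizing_map_def Let_def T_def
      by (simp add: C.scale_right_distrib)
    define U' where "U' = {\<epsilon>\<in>U. norm (b \<epsilon>) < \<delta>}"
    have half: "norm (- inv (b \<epsilon>)) < \<rho> / 2" if "\<epsilon> \<in> U'" for \<epsilon>
    proof -
      have "M * norm (b \<epsilon>) < M * \<delta>" using that \<open>M > 0\<close> by (simp add: U'_def)
      also have "M * \<delta> = \<rho> / 2" using \<open>M > 0\<close> by (simp add: \<delta>_def)
      finally show ?thesis using M[of "b \<epsilon>"] by simp
    qed
    have V: "(\<phi> - inv (b \<epsilon>), n) \<in> ?V"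
      if "\<epsilon> \<in> U'" "\<phi> \<in> X" "n \<in> N" "norm \<phi> < \<rho> / 4" "norm n < \<rho> / 4" for \<epsilon> \<phi> n
    proof -
      have "norm (\<phi> - inv (b \<epsilon>), n) < \<rho>"
        using norm_Pair_le[of "\<phi> - inv (b \<epsilon>)" n] norm_triangle_ineq4[of \<phi> "inv (b \<epsilon>)"]
          half[OF that(1)] that(4,5) by simp
      then show ?thesis
        using subspace_diff[OF X that(2) invX] that(3) unfolding Vball_def X_def by simp
    qed
    have "{x \<in> ?cone \<epsilon> ` ?V. G x = 0} = {?cone \<epsilon> (- inv (b \<epsilon>), n) | n. (- inv (b \<epsilon>), n) \<in> ?V}"
      if "\<epsilon> \<in> U' - {0}" for \<epsilon>
    proof -
      have \<epsilon>: "\<epsilon> \<in> U" "\<epsilon> \<noteq> 0" using that by (auto simp: U'_def)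
      have "G (?cone \<epsilon> (\<phi>, n)) = 0 \<longleftrightarrow> \<phi> = - inv (b \<epsilon>)" if "(\<phi>, n) \<in> ?V" for \<phi> n
      proof -
        have "\<phi> \<in> X" using that by (simp add: Vball_def X_def)
        \<comment> \<open>The factor \<open>\<epsilon> ^ (2 * k)\<close> is nonzero and cancels.
          Writing \<open>b \<epsilon>\<close> as \<open>T (inv (b \<epsilon>))\<close> leaves an
          equation between values of \<open>T\<close>, which injectivity on \<open>X\<close>
          solves.\<close>
        have "G (?cone \<epsilon> (\<phi>, n)) = 0 \<longleftrightarrow> T \<phi> = T (- inv (b \<epsilon>))"
          using \<epsilon> by (simp add: cone[OF _ that] T.neg T_inv eq_neg_iff_add_eq_0 add.commute[of "b \<epsilon>"])
        also have "\<dots> \<longleftrightarrow> \<phi> = - inv (b \<epsilon>)"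
          using inj_on_eq_iff[OF injT \<open>\<phi> \<in> X\<close> subspace_neg[OF X invX]] .
        finally show ?thesis .
      qed
      then show ?thesis by force
    qed
    moreover have "G (?cone \<epsilon> (\<phi> + - inv (b \<epsilon>), n)) = sC (\<epsilon> ^ (2 * k)) (T \<phi>)"
      if "\<epsilon> \<in> U'" "\<phi> \<in> X" "n \<in> N" "norm \<phi> < \<rho> / 4" "norm n < \<rho> / 4" for \<epsilon> \<phi> n
      using that V[OF that] by (simp add: cone U'_def T.diff T_inv)
    moreover have "open U'"
      unfolding U'_def by (intro sublevel[OF U(1) b(1)] open_Collect_less continuous_intros)
    moreover have "U' \<subseteq> U" "0 \<in> U'" using U(2) b(2) by (auto simp: U'_def)
    moreover have "- inv y \<in> X" for y by (rule subspace_neg[OF X invX])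
    ultimately show "\<exists>U'\<subseteq>U. open U' \<and> 0 \<in> U' \<and> (\<forall>\<epsilon>\<in>U'. - inv (b \<epsilon>) \<in> X) \<and>
        (\<exists>\<sigma>>0. \<forall>\<epsilon>\<in>U'. \<forall>\<phi>\<in>X. \<forall>n\<in>N. norm \<phi> < \<sigma> \<and> norm n < \<sigma> \<longrightarrow>
           (\<phi> + - inv (b \<epsilon>), n) \<in> ?V \<and>
           G (?cone \<epsilon> (\<phi> + - inv (b \<epsilon>), n)) = sC (\<epsilon> ^ (2 * k)) (T \<phi>)) \<and>
        (\<forall>\<epsilon>\<in>U' - {0}. {x \<in> ?cone \<epsilon> ` ?V. G x = 0} =
           {?cone \<epsilon> (- inv (b \<epsilon>), n) | n. (- inv (b \<epsilon>), n) \<in> ?V})"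
      using V \<open>\<rho> > 0\<close> by (intro exI[of _ U'] conjI exI[of _ "\<rho> / 4"]) auto
  next

    \<comment> \<open>Residual of lower order: no zeros\<close>
    fix r s :: nat and U :: "'k set" and G z Ph \<Psi> and q :: nat and b :: "'k \<Rightarrow> 'c"
    assume U: "open U" "0 \<in> U" and lin: "linearizing_map sB sC s k Nc N S Ph G z U \<rho> \<Psi>"
      and "1 \<le> k" and q: "q \<le> 2 * k - 1" and b: "C_on (*) sC s UNIV U b" "b 0 \<noteq> 0"
      and Gz: "\<forall>\<epsilon>\<in>U. G (z \<epsilon>) = sC (\<epsilon> ^ q) (b \<epsilon>)"
    let ?V = "Vball k Nc N \<rho>" and ?cone = "cone_map sB k Ph z \<Psi>"
    \<comment> \<open>The exponent \<open>2 * k - q\<close> becomes \<open>Suc p\<close>, so at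
      least one factor \<open>\<epsilon>\<close> stays in front of \<open>T\<close>. Since
      subtraction is truncated, \<open>q \<le> 2 * k - 1\<close> gives \<open>q < 2 * k\<close> only
      together with \<open>1 \<le> k\<close>.\<close>
    define p where "p = 2 * k - 1 - q"
    have p: "2 * k = q + Suc p" using q \<open>1 \<le> k\<close> by (simp add: p_def)
    have cone: "G (?cone \<epsilon> w) = sC (\<epsilon> ^ q) (b \<epsilon> + sC (\<epsilon> ^ Suc p) (T (fst w)))"
      if "\<epsilon> \<in> U" "w \<in> ?V" for \<epsilon> w
      using lin Gz that unfolding linearizing_map_def Let_def T_def p power_add
      by (simp add: C.scale_right_distrib)
    define \<beta> where "\<beta> = norm (b 0) / 2"
    have "\<beta> > 0" using b(2) by (simp add: \<beta>_def)
    \<comment> \<open>The bound 1 gives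
      \<open>norm \<epsilon> ^ Suc p \<le> norm \<epsilon>\<close>; the other bound keeps the
      perturbation, at most \<open>norm \<epsilon> * (\<rho> * K)\<close> on \<open>V\<close>,
      within \<open>\<beta>\<close>. By continuity \<open>b \<epsilon>\<close> still exceeds
      \<open>\<beta>\<close> in norm near 0, so the two terms cannot cancel.\<close>
    define \<eta> where "\<eta> = min 1 (\<beta> / (\<rho> * K))"
    have "\<eta> > 0" using \<open>\<beta> > 0\<close> \<open>\<rho> > 0\<close> \<open>K > 0\<close> by (simp add: \<eta>_def)
    define U' where "U' = {\<epsilon>\<in>U. norm (b \<epsilon>) > \<beta>} \<inter> ball 0 \<eta>"
    have "G (?cone \<epsilon> w) \<noteq> 0" if \<epsilon>: "\<epsilon> \<in> U' - {0}" and w: "w \<in> ?V" for \<epsilon> w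
    proof
      assume "G (?cone \<epsilon> w) = 0"
      then have "b \<epsilon> = - sC (\<epsilon> ^ Suc p) (T (fst w))"
        using \<epsilon> w by (simp add: cone U'_def eq_neg_iff_add_eq_0)
      then have "norm (b \<epsilon>) = norm \<epsilon> ^ Suc p * norm (T (fst w))"
        by (simp only: norm_minus_cancel C.norm_scale norm_power)
      also have "\<dots> \<le> norm \<epsilon> * (\<rho> * K)"
      proof (rule mult_mono)
        show "norm \<epsilon> ^ Suc p \<le> norm \<epsilon>"
          using \<epsilon> by (simp add: U'_def \<eta>_def mult_left_le power_le_one)
        have "norm (fst w) \<le> \<rho>"
          using w norm_fst_le[of "fst w" "snd w"] by (simp add: Vball_def)
        then show "norm (T (fst w)) \<le> \<rho> * K"
          using K[of "fst w"] mult_right_mono[of "norm (fst w)" \<rho> K] \<open>K > 0\<close> by linarith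
      qed auto
      also have "\<dots> \<le> \<beta>"
        using \<epsilon> \<open>\<rho> > 0\<close> \<open>K > 0\<close> by (simp add: U'_def \<eta>_def field_simps)
      finally show False using \<epsilon> by (simp add: U'_def)
    qed
    moreover have "open U'"
      unfolding U'_def
      by (intro open_Int open_ball sublevel[OF U(1) b(1)] open_Collect_less continuous_intros)
    moreover have "U' \<subseteq> U" "0 \<in> U'"
      using U(2) b(2) \<open>\<eta> > 0\<close> by (auto simp: U'_def \<beta>_def)
    ultimately show "\<exists>U'\<subseteq>U. open U' \<and> 0 \<in> U' \<and> (\<forall>\<epsilon>\<in>U' - {0}. \<forall>x\<in>?cone \<epsilon> ` ?V. G x \<noteq> 0)"
      by (intro exI[of _ U']) blast
  qed
qed

end
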